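(* Let $k\ge 1$ be an integer and $X$ a graph. If $D_k(X)\setminus D_{k-1}(X)\ne\emptyset$, then $\omega(X)\ge k+2$. Moreover, if $x\in D_k(X)\setminus D_{k-1}(X)$, then there is a clique of $X$ with $k+2$ vertices which contains $x$.
   Context: All graphs are finite, undirected, without loops or multiple edges, with at least one vertex. For a graph $X$ and a vertex $x$, $N_X(x)$ is the set of neighbours of $x$, identified with the subgraph of $X$ it induces, and $N_X[x]=N_X(x)\cup\{x\}$. A graph $X$ is a cone if it has a vertex $x$ with $N_X[x]=V(X)$; the one-vertex graph is a cone. Let $D_{-1}$ be the class of cones. Inductively, for an integer $k\ge 0$: a vertex $x$ of $X$ is $k$-dismantlable if $N_X(x)$ is non-empty and the graph $N_X(x)$ belongs to $D_{k-1}$; a graph is $k$-dismantlable if it can be reduced to a single vertex by successively deleting vertices, each being $k$-dismantlable in the current graph; $D_k$ is the class of $k$-dismantlable graphs. For $k\ge 0$, $D_k(X)$ denotes the set of $k$-dismantlable vertices of $X$. A clique is a complete subgraph, and $\omega(X)$ is the maximum number of vertices of a clique of $X$. *)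

theory Defs
  imports "Graph_Theory.Graph_Theory"
begin

definition neighbours :: "('a, 'b) pre_digraph \<Rightarrow> 'a \<Rightarrow> 'a set" where
  "neighbours X x = {y \<in> verts X. x \<rightarrow>\<^bsub>X\<^esub> y}"

definition closed_neighbours :: "('a, 'b) pre_digraph \<Rightarrow> 'a \<Rightarrow> 'a set" where
  "closed_neighbours X x = insert x (neighbours X x)"

definition cone :: "('a, 'b) pre_digraph \<Rightarrow> bool" where
  "cone X \<longleftrightarrow> (\<exists>x \<in> verts X. closed_neighbours X x = verts X)"

text \<open>
  \<open>reducible P X\<close>: \<open>X\<close> can be reduced to a single vertex by successively deleting vertices,
  each of which lies in \<open>P Y\<close> for the graph \<open>Y\<close> from which it is deleted.
\<close>

inductive reducible :: "(('a, 'b) pre_digraph \<Rightarrow> 'a set) \<Rightarrow> ('a, 'b) pre_digraph \<Rightarrow> bool"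
  for P where
  point: "card (verts X) = 1 \<Longrightarrow> reducible P X"
| delete: "x \<in> P X \<Longrightarrow> reducible P (pre_digraph.del_vert X x) \<Longrightarrow> reducible P X"

text \<open>
  \<open>dismantlable_verts k X\<close> is the set $D_k(X)$ and \<open>dismantlable k X\<close> says that \<open>X\<close> is in the
  class $D_k$, for $k \ge 0$; the class $D_{-1}$ is the predicate \<open>cone\<close>. The formula for
  \<open>Suc k\<close> inlines \<open>dismantlable k\<close>; see \<open>dismantlable_verts_Suc\<close>.
\<close>

primrec dismantlable_verts :: "nat \<Rightarrow> ('a, 'b) pre_digraph \<Rightarrow> 'a set" where
  "dismantlable_verts 0 =
    (\<lambda>X. {x \<in> verts X. neighbours X x \<noteq> {} \<and> cone (X \<restriction> neighbours X x)})"
| "dismantlable_verts (Suc k) =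
    (\<lambda>X. {x \<in> verts X. neighbours X x \<noteq> {} \<and>
                        reducible (dismantlable_verts k) (X \<restriction> neighbours X x)})"

definition dismantlable :: "nat \<Rightarrow> ('a, 'b) pre_digraph \<Rightarrow> bool" where
  "dismantlable k X \<longleftrightarrow> reducible (dismantlable_verts k) X"

lemma dismantlable_verts_Suc:
  "dismantlable_verts (Suc k) X =
    {x \<in> verts X. neighbours X x \<noteq> {} \<and> dismantlable k (X \<restriction> neighbours X x)}"
  by (simp add: dismantlable_def)

definition clique :: "('a, 'b) pre_digraph \<Rightarrow> 'a set \<Rightarrow> bool" where
  "clique X S \<longleftrightarrow> S \<subseteq> verts X \<and> complete_digraph (card S) (X \<restriction> S)"

definition clique_number :: "('a, 'b) pre_digraph \<Rightarrow> nat" where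
  "clique_number X = Max (card ` {S. clique X S})"

text \<open>The maximum is over a finite non-empty set, and the library's complete graphs
  give the usual description of cliques by pairwise adjacency.\<close>

lemma clique_iff:
  assumes "graph X"
  shows "clique X S \<longleftrightarrow> S \<subseteq> verts X \<and> (\<forall>u \<in> S. \<forall>v \<in> S. u \<noteq> v \<longrightarrow> u \<rightarrow>\<^bsub>X\<^esub> v)"
proof -
  interpret graph X by fact
  have ends: "arcs_ends (X \<restriction> S) = {(u, v). u \<in> S \<and> v \<in> S \<and> u \<rightarrow>\<^bsub>X\<^esub> v}"
    by (auto simp: arcs_ends_conv)
  have "graph (X \<restriction> S)" if "S \<subseteq> verts X"
  proof -
    interpret S: sym_digraph "X \<restriction> S"
      using that by (blast intro: induced_graph_imp_graph)
    show ?thesis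
      by unfold_locales (auto simp: arc_to_ends_def dest: no_loops intro: no_multi_arcs
        intro: finite_subset[OF that])
  qed
  then show ?thesis
    unfolding clique_def complete_digraph_def ends by (auto dest: adj_not_same)
qed

lemma finite_cliques:
  assumes "graph X"
  shows "finite {S. clique X S}" "clique X {}"
proof -
  interpret graph X by fact
  show "finite {S. clique X S}"
    by (rule finite_subset[of _ "Pow (verts X)"]) (auto simp: clique_def)
  show "clique X {}" by (simp add: clique_iff[OF assms])
qed

end

theory Submission
  imports Defs
begin

text \<open>
  The idea is that a clique can be built from the inside out by following the failures of
  lower-order dismantlability. If \<open>x\<close> is $k$-dismantlable but not $(k-1)$-dismantlable, then its
  neighbourhood is in the class $D_{k-1}$ but not in $D_{k-2}$. Take any reduction of the
  neighbourhood to a point that deletes $(k-1)$-dismantlable vertices. For $k \ge 2$, some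
  vertex deleted on the way is not $(k-2)$-dismantlable at the moment of its deletion: otherwise
  the same reduction would put the neighbourhood in $D_{k-2}$. This vertex lies in
  $D_{k-1}(Y) \setminus D_{k-2}(Y)$ for an induced subgraph $Y$ of the neighbourhood
  (\<open>reducible_gap\<close>), so induction on $k$ gives a clique with $k+1$ vertices in $Y$, and adding
  \<open>x\<close> to it gives the clique sought (\<open>clique_insert_apex\<close>).

  The induction starts at $k = 1$, where $D_{-1}$ is the class of cones. The neighbourhood of
  \<open>x\<close> is not a cone, hence not a point, so its reduction deletes at least one vertex. A deleted
  vertex has a neighbour, and this edge together with \<open>x\<close> is a triangle
  (\<open>reducible_not_cone_clique\<close>).
\<close>

lemma graph_induce_subgraph:
  assumes "graph X" and "S \<subseteq> verts X"
  shows "graph (X \<restriction> S)"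
proof -
  interpret graph X by fact
  interpret S: sym_digraph "X \<restriction> S"
    using assms(2) by (blast intro: induced_graph_imp_graph)
  show ?thesis
    by unfold_locales (auto simp: arc_to_ends_def dest: no_loops intro: no_multi_arcs
      intro: finite_subset[OF assms(2)])
qed

lemma (in wf_digraph) induce_subgraph_verts: "G \<restriction> verts G = G"
  by (rule pre_digraph.equality) auto

lemma (in wf_digraph) del_vert_conv_induce_subgraph:
  "pre_digraph.del_vert G x = G \<restriction> (verts G - {x})"
  by (auto simp: del_vert_def induce_subgraph_def)

lemma induce_subgraph_induce_subgraph:
  "T \<subseteq> S \<Longrightarrow> (X \<restriction> S) \<restriction> T = X \<restriction> T"
  by (auto simp: induce_subgraph_def)

lemma adj_induce_subgraph:
  "u \<rightarrow>\<^bsub>X \<restriction> S\<^esub> v \<longleftrightarrow> u \<in> S \<and> v \<in> S \<and> u \<rightarrow>\<^bsub>X\<^esub> v"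
  by (auto simp: arcs_ends_conv)

lemma clique_induce_subgraph:
  assumes "graph X" and "S \<subseteq> verts X"
  shows "clique (X \<restriction> S) T \<longleftrightarrow> T \<subseteq> S \<and> clique X T"
  using assms by (auto simp: clique_iff graph_induce_subgraph adj_induce_subgraph)

lemma clique_insert_apex:
  assumes "graph X" and "x \<in> verts X" and "clique (X \<restriction> neighbours X x) T"
  shows "clique X (insert x T)" and "card (insert x T) = Suc (card T)"
proof -
  interpret graph X by fact
  have "neighbours X x \<subseteq> verts X" by (auto simp: neighbours_def)
  with assms have T: "T \<subseteq> neighbours X x" "clique X T"
    by (simp_all add: clique_induce_subgraph)
  have adj: "x \<rightarrow>\<^bsub>X\<^esub> v \<and> v \<rightarrow>\<^bsub>X\<^esub> x" if "v \<in> T" for v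
    using that T(1) by (auto simp: neighbours_def intro: graph_symmetric)
  show "clique X (insert x T)"
    using T(2) adj assms(1,2) by (auto simp: clique_iff)
  have "x \<notin> T" using adj adj_not_same by blast
  moreover have "finite T"
    using T(2) assms(1) by (auto simp: clique_iff intro: finite_subset)
  ultimately show "card (insert x T) = Suc (card T)" by simp
qed

text \<open>
  A reduction that deletes only vertices in \<open>P\<close> is also one for \<open>Q\<close> unless it deletes a vertex
  outside \<open>Q\<close> at some stage, and every stage is an induced subgraph.
\<close>

lemma reducible_gap:
  assumes "reducible P X" and "graph X" and "\<not> reducible Q X"
  shows "\<exists>S \<subseteq> verts X. \<exists>y. y \<in> P (X \<restriction> S) - Q (X \<restriction> S)"
  using assms
proof (induction rule: reducible.induct)
  case (point X)
  then show ?case by (simp add: reducible.point)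
next
  case (delete x X)
  interpret graph X by fact
  show ?case
  proof (cases "x \<in> Q X")
    case False
    with delete.hyps(1) show ?thesis
      by (intro exI[of _ "verts X"]) (auto simp: induce_subgraph_verts)
  next
    case True
    let ?V = "verts X - {x}"
    have del: "pre_digraph.del_vert X x = X \<restriction> ?V"
      by (rule del_vert_conv_induce_subgraph)
    have "graph (X \<restriction> ?V)" by (rule graph_induce_subgraph) (use delete.prems in auto)
    moreover have "\<not> reducible Q (X \<restriction> ?V)"
      using True delete.prems(2) reducible.delete[of x Q X] by (auto simp: del)
    ultimately obtain S y where "S \<subseteq> ?V"
      and "y \<in> P ((X \<restriction> ?V) \<restriction> S) - Q ((X \<restriction> ?V) \<restriction> S)"
      using delete.IH by (auto simp: del)
    then show ?thesis
      by (intro exI[of _ S]) (auto simp: induce_subgraph_induce_subgraph)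
  qed
qed

lemma reducible_not_cone_clique:
  assumes "graph X" and "reducible (dismantlable_verts 0) X" and "\<not> cone X"
  shows "\<exists>S. clique X S \<and> card S = 2"
  using assms(2)
proof cases
  case point
  then obtain v where "verts X = {v}" by (auto simp: card_1_singleton_iff)
  then have "cone X" by (auto simp: cone_def closed_neighbours_def neighbours_def)
  with assms(3) show ?thesis by simp
next
  case (delete x)
  interpret graph X by fact
  from delete(1) obtain y where xy: "x \<in> verts X" "y \<in> verts X" "x \<rightarrow>\<^bsub>X\<^esub> y"
    by (auto simp: neighbours_def)
  then have "x \<noteq> y" using adj_not_same by blast
  moreover have "clique X {x, y}"
    using xy assms(1) by (auto simp: clique_iff intro: graph_symmetric)
  ultimately show ?thesis by (intro exI[of _ "{x, y}"]) simp
qed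

text \<open>
  The subgraph that carries the smaller clique varies along the induction, so the statement is
  proved for all graphs at once. The index is shifted by one to have a natural number for the
  order of dismantlability that fails.
\<close>

lemma dismantlable_gap_clique:
  assumes "graph X" and "x \<in> dismantlable_verts (Suc n) X - dismantlable_verts n X"
  shows "\<exists>S. clique X S \<and> card S = n + 3 \<and> x \<in> S"
  using assms
proof (induction n arbitrary: X x)
  case (0 X x)
  let ?N = "X \<restriction> neighbours X x"
  have N: "graph ?N"
    by (rule graph_induce_subgraph) (use 0 in \<open>auto simp: neighbours_def\<close>)
  from 0(2) have x: "x \<in> verts X"
    and "reducible (dismantlable_verts 0) ?N" "\<not> cone ?N"
    by auto
  with N obtain T where T: "clique ?N T" "card T = 2"
    using reducible_not_cone_clique by blast
  show ?case
    using clique_insert_apex[OF 0(1) x T(1)] T(2)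
    by (intro exI[of _ "insert x T"]) simp
next
  case (Suc n X x)
  let ?N = "X \<restriction> neighbours X x"
  have N: "graph ?N"
    by (rule graph_induce_subgraph) (use Suc in \<open>auto simp: neighbours_def\<close>)
  from Suc.prems(2) have x: "x \<in> verts X"
    and "dismantlable (Suc n) ?N" "\<not> dismantlable n ?N"
    unfolding dismantlable_verts_Suc by auto
  with N obtain S y where S: "S \<subseteq> verts ?N"
    and y: "y \<in> dismantlable_verts (Suc n) (?N \<restriction> S) - dismantlable_verts n (?N \<restriction> S)"
    unfolding dismantlable_def using reducible_gap by blast
  obtain T where T: "clique (?N \<restriction> S) T" "card T = n + 3"
    using Suc.IH[OF graph_induce_subgraph[OF N S] y] by blast
  have "clique ?N T" using T(1) N S by (simp only: clique_induce_subgraph)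
  from clique_insert_apex[OF Suc.prems(1) x this] T(2) show ?case
    by (intro exI[of _ "insert x T"]) simp
qed

theorem proposition14:
  fixes X :: "('a, 'b) pre_digraph" and k :: nat
  assumes "graph X" and "verts X \<noteq> {}" and "k \<ge> 1"
  shows "(dismantlable_verts k X - dismantlable_verts (k - 1) X \<noteq> {}
           \<longrightarrow> clique_number X \<ge> k + 2)
       \<and> (\<forall>x \<in> dismantlable_verts k X - dismantlable_verts (k - 1) X.
             \<exists>S. clique X S \<and> card S = k + 2 \<and> x \<in> S)"
proof -
  have vertex: "\<exists>S. clique X S \<and> card S = k + 2 \<and> x \<in> S"
    if "x \<in> dismantlable_verts k X - dismantlable_verts (k - 1) X" for x
    using dismantlable_gap_clique[OF assms(1), of x "k - 1"] that assms(3) by simp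
  have "k + 2 \<le> clique_number X" if S: "clique X S" "card S = k + 2" for S
  proof -
    have "card S \<le> clique_number X"
      unfolding clique_number_def using S(1) finite_cliques(1)[OF assms(1)]
      by (intro Max_ge) auto
    with S(2) show ?thesis by simp
  qed
  with vertex show ?thesis by blast
qed

end
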